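(* Let $(\mathcal Q,d)$ be a Hadamard space, let $\tau\in\mathcal S_0^+$ with $D:=\lim_{x\to\infty}\tau'(x)<\infty$, let $Y$ be a $\mathcal Q$-valued random variable concentrated on a separable set, and let $m$ be a $\tau$-Fréchet mean of $Y$. Let $\mathcal B\subset\mathcal Q$ be a convex and closed set with diameter $\operatorname{diam}(\mathcal B)\le\delta\in[0,\infty)$. Set $\rho:=\mathbf P(Y\in\mathcal B)$. Let $R\in(0,\infty)$ and $\lambda\in(0,1]$ be such that $\tau(R)\ge\lambda DR$. Assume $\rho>\frac1{1+\lambda}$. Set $a:=\frac{1-\rho}{\rho}$ and $$x_0:=\frac{\delta}{\lambda-a}\cdot\frac{a+\lambda\sqrt{1-\lambda^2+a^2}}{a+\lambda}.$$ Then $$d(m,\mathcal B)^2\le\max\big(x_0^2,\;R^2-\delta^2\big),$$ where $d(m,\mathcal B):=\inf_{q\in\mathcal B}d(q,m)$.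
   Context: A Hadamard space is a nonempty complete metric space $(\mathcal Q,d)$ such that for all $y_0,y_1\in\mathcal Q$ there is $p\in\mathcal Q$ with $\frac12 d(y_0,q)^2+\frac12 d(y_1,q)^2-\frac14 d(y_0,y_1)^2\ge d(q,p)^2$ for all $q\in\mathcal Q$; any two points are joined by a unique unit-speed geodesic, and a set is convex if it contains the geodesic between any two of its points. The space carries its Borel $\sigma$-algebra. "Concentrated on a separable set" means $\mathbf P(Y\in\mathcal Y)=1$ for some separable $\mathcal Y\subset\mathcal Q$. $\mathcal S_0^+$ is the set of nondecreasing convex functions $\tau\colon[0,\infty)\to\mathbb R$ with $\tau(0)=0$ that are differentiable on $(0,\infty)$ with concave derivative $\tau'$ satisfying $\tau'(x)>0$ for all $x>0$. A $\tau$-Fréchet mean of $Y$ is any $m\in\arg\min_{q\in\mathcal Q}\mathbf E[\tau(d(Y,q))-\tau(d(Y,o))]$, where $o\in\mathcal Q$ is an arbitrary reference point (the set of minimizers does not depend on $o$; the general integrability requirement $\mathbf E[\tau'(d(Y,o))]<\infty$ holds automatically as $\tau'$ is bounded). *)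

theory Defs
  imports "HOL-Probability.Probability"
begin

text \<open>
  Completeness comes from \<^class>\<open>complete_space\<close>, and nonemptiness from the fact that
  every type is inhabited.
\<close>

class hadamard_space = complete_space +
  assumes midpoint_inequality:
    "\<exists>p. \<forall>q. (1/2) * (dist y0 q)\<^sup>2 + (1/2) * (dist y1 q)\<^sup>2 - (1/4) * (dist y0 y1)\<^sup>2
           \<ge> (dist q p)\<^sup>2"

definition unit_speed_geodesic :: "(real \<Rightarrow> 'a::metric_space) \<Rightarrow> 'a \<Rightarrow> 'a \<Rightarrow> bool" where
  "unit_speed_geodesic \<gamma> x y \<longleftrightarrow>
     \<gamma> 0 = x \<and> \<gamma> (dist x y) = y \<and>
     (\<forall>s\<in>{0..dist x y}. \<forall>t\<in>{0..dist x y}. dist (\<gamma> s) (\<gamma> t) = \<bar>s - t\<bar>)"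

text \<open>
  In a Hadamard space the geodesic from \<^term>\<open>x\<close> to \<^term>\<open>y\<close> exists and is unique on
  \<^term>\<open>{0..dist x y}\<close>, so quantifying over all geodesics means speaking of the geodesic.
\<close>

definition geodesically_convex :: "'a::hadamard_space set \<Rightarrow> bool" where
  "geodesically_convex B \<longleftrightarrow>
     (\<forall>x\<in>B. \<forall>y\<in>B. \<forall>\<gamma>. unit_speed_geodesic \<gamma> x y \<longrightarrow> \<gamma> ` {0..dist x y} \<subseteq> B)"

text \<open>
  The class \<open>S\<^sub>0\<^sup>+\<close> of transformations. They are functions on the half-line \<^term>\<open>{0..}\<close>;
  values at negative arguments are unconstrained and irrelevant.
\<close>

definition S0_plus :: "(real \<Rightarrow> real) set" where
  "S0_plus = {\<tau>. mono_on {0..} \<tau> \<and> convex_on {0..} \<tau> \<and> \<tau> 0 = 0 \<and>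
                 (\<forall>x>0. \<tau> differentiable (at x)) \<and>
                 concave_on {0<..} (deriv \<tau>) \<and>
                 (\<forall>x>0. deriv \<tau> x > 0)}"

text \<open>
  Minimizers of the expected \<open>\<tau>\<close>-increment relative to a reference point \<^term>\<open>z\<close>. If
  \<^term>\<open>\<tau> \<in> S0_plus\<close> and \<^term>\<open>deriv \<tau>\<close> is bounded by \<^term>\<open>D\<close>, the integrand is bounded
  by \<^term>\<open>D * dist q z\<close>, hence integrable for every \<^term>\<open>q\<close>; the definition is meant only
  for transformations and random variables with this integrability.
\<close>

definition frechet_mean ::
  "(real \<Rightarrow> real) \<Rightarrow> 'w measure \<Rightarrow> ('w \<Rightarrow> 'a::metric_space) \<Rightarrow> 'a \<Rightarrow> 'a \<Rightarrow> bool" where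
  "frechet_mean \<tau> M Y z m \<longleftrightarrow>
     is_arg_min (\<lambda>q. \<integral>\<omega>. \<tau> (dist (Y \<omega>) q) - \<tau> (dist (Y \<omega>) z) \<partial>M) (\<lambda>q. True) m"

end

theory Submission
  imports Defs
begin

text \<open>
  Write \<open>h = d(m, B)\<close> and let \<open>b\<close> be the point of \<open>B\<close> nearest to \<open>m\<close>. The bound expresses that
  moving \<open>m\<close> slightly towards \<open>b\<close> must not lower the objective. Let \<open>y \<in> B\<close>, \<open>A = d(y, m)\<close> and
  \<open>c = d(y, b) \<le> \<delta>\<close>. Nonpositive curvature and convexity of \<open>B\<close> give
  \<open>A\<^sup>2 \<ge> c\<^sup>2 + h\<^sup>2\<close> (\<open>projection_pythagoras\<close>), and such a move decreases the cost
  \<open>\<tau> (d(y, \<cdot>))\<close> at unit speed by at least \<open>\<tau>' A (A\<^sup>2 + h\<^sup>2 - c\<^sup>2) / (2 A h)\<close>. Put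
  \<open>S = \<surd>(h\<^sup>2 + \<delta>\<^sup>2)\<close>. Since \<open>\<tau>'\<close> is nondecreasing and \<open>\<tau>' x / x\<close> is nonincreasing, this rate is at
  least \<open>\<tau>' S h / S\<close>, its value for \<open>A = S\<close> and \<open>c = \<delta>\<close> (\<open>S0_plus_projection_slope\<close>). For
  \<open>y \<notin> B\<close> the cost grows at rate at most \<open>D\<close>. Minimality of \<open>m\<close> therefore yields
  \<open>\<rho> \<tau>' S h / S \<le> (1 - \<rho>) D\<close> (\<open>frechet_mean_first_order\<close>).

  If \<open>h\<^sup>2 > R\<^sup>2 - \<delta>\<^sup>2\<close>, then \<open>S > R\<close>, and convexity of \<open>\<tau>\<close> gives
  \<open>\<tau>' S \<ge> \<tau>' R \<ge> \<tau> R / R \<ge> \<lambda> D\<close>. Then \<open>\<lambda> h \<le> a \<surd>(h\<^sup>2 + \<delta>\<^sup>2)\<close>, that is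
  \<open>h \<le> a \<delta> / \<surd>(\<lambda>\<^sup>2 - a\<^sup>2)\<close>. As \<open>\<lambda>\<^sup>2 - a\<^sup>2 \<le> 1\<close>, this is at most \<open>a \<delta> / (\<lambda>\<^sup>2 - a\<^sup>2)\<close>, which in turn
  is at most \<open>x\<^sub>0\<close>.

  Only two facts about geodesics are used. The first is that geodesics exist, so that a convex
  set contains the midpoints of its points. The second is the comparison inequality at the
  fractions \<open>2\<^sup>-\<^sup>n\<close>, which follows from the midpoint inequality by induction. Taking these fractions
  as step sizes, the first-order argument needs no directional derivatives of the distance.
\<close>

section \<open>Midpoints and geodesics in Hadamard spaces\<close>

definition hmid :: "'a::hadamard_space \<Rightarrow> 'a \<Rightarrow> 'a" where
  "hmid x y = (SOME p. \<forall>q. (1/2) * (dist x q)\<^sup>2 + (1/2) * (dist y q)\<^sup>2 - (1/4) * (dist x y)\<^sup>2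
                 \<ge> (dist q p)\<^sup>2)"

lemma hmid_inequality:
  "(dist q (hmid x y))\<^sup>2 \<le> (1/2) * (dist x q)\<^sup>2 + (1/2) * (dist y q)\<^sup>2 - (1/4) * (dist x y)\<^sup>2"
  using someI_ex[OF midpoint_inequality[of x y]] unfolding hmid_def by blast

lemma dist_hmid_left: "dist x (hmid x y) \<le> dist x y / 2"
proof -
  have "(dist x (hmid x y))\<^sup>2 \<le> (dist x y / 2)\<^sup>2"
    using hmid_inequality[of x x y] by (simp add: dist_commute power_divide)
  then show ?thesis by (rule power2_le_imp_le) simp
qed

lemma dist_hmid_right: "dist (hmid x y) y \<le> dist x y / 2"
proof -
  have "(dist y (hmid x y))\<^sup>2 \<le> (dist x y / 2)\<^sup>2"
    using hmid_inequality[of y x y] by (simp add: dist_commute power_divide)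
  then have "dist y (hmid x y) \<le> dist x y / 2" by (rule power2_le_imp_le) simp
  then show ?thesis by (simp add: dist_commute)
qed

lemma hmid_unique:
  assumes "dist x q = dist x y / 2" and "dist y q = dist x y / 2"
  shows "q = hmid x y"
proof -
  have "(dist q (hmid x y))\<^sup>2 \<le> 0"
    using hmid_inequality[of q x y] assms by (simp add: power_divide)
  then show ?thesis by simp
qed

text \<open>
  Stage \<open>n\<close> of the binary search for the point at fraction \<open>t\<close> of the way from \<open>x\<close> to \<open>y\<close>:
  each digit of \<open>t\<close> selects one half of the current segment, and the search returns the left
  end of the segment it has reached.
\<close>

primrec dyadic_walk :: "nat \<Rightarrow> 'a::hadamard_space \<Rightarrow> 'a \<Rightarrow> real \<Rightarrow> 'a" where
  "dyadic_walk 0 x y t = x"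
| "dyadic_walk (Suc n) x y t =
     (if t < 1/2 then dyadic_walk n x (hmid x y) (2 * t)
      else dyadic_walk n (hmid x y) y (2 * t - 1))"

lemma dyadic_walk_dist_left:
  assumes "0 \<le> t"
  shows "dist x (dyadic_walk n x y t) \<le> t * dist x y"
  using assms
proof (induction n arbitrary: x y t)
  case 0
  then show ?case by simp
next
  case (Suc n)
  show ?case
  proof (cases "t < 1/2")
    case True
    have "dist x (dyadic_walk n x (hmid x y) (2 * t)) \<le> 2 * t * dist x (hmid x y)"
      using Suc.IH[of "2 * t" x "hmid x y"] Suc.prems by simp
    also have "\<dots> \<le> 2 * t * (dist x y / 2)"
      using dist_hmid_left[of x y] Suc.prems by (intro mult_left_mono) auto
    finally show ?thesis using True by simp
  next
    case False
    have "dist (hmid x y) (dyadic_walk n (hmid x y) y (2 * t - 1)) \<le> (2 * t - 1) * dist (hmid x y) y"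
      using Suc.IH[of "2 * t - 1" "hmid x y" y] False by simp
    also have "\<dots> \<le> (2 * t - 1) * (dist x y / 2)"
      using dist_hmid_right[of x y] False by (intro mult_left_mono) auto
    finally have "dist x (dyadic_walk n (hmid x y) y (2 * t - 1))
        \<le> dist x y / 2 + (2 * t - 1) * (dist x y / 2)"
      using dist_triangle[of x "dyadic_walk n (hmid x y) y (2 * t - 1)" "hmid x y"]
        dist_hmid_left[of x y] by linarith
    also have "\<dots> = t * dist x y" by (simp add: field_simps)
    finally show ?thesis using False by simp
  qed
qed

lemma dyadic_walk_dist_right:
  assumes "t \<le> 1"
  shows "dist (dyadic_walk n x y t) y \<le> (1 - t + (1/2)^n) * dist x y"
  using assms
proof (induction n arbitrary: x y t)
  case 0
  then show ?case
    using mult_right_mono[of 1 "2 - t" "dist x y"] by simp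
next
  case (Suc n)
  show ?case
  proof (cases "t < 1/2")
    case True
    have "dist (dyadic_walk n x (hmid x y) (2 * t)) (hmid x y)
        \<le> (1 - 2 * t + (1/2)^n) * dist x (hmid x y)"
      using Suc.IH[of "2 * t" x "hmid x y"] True by simp
    also have "\<dots> \<le> (1 - 2 * t + (1/2)^n) * (dist x y / 2)"
      using dist_hmid_left[of x y] True by (intro mult_left_mono) auto
    finally have "dist (dyadic_walk n x (hmid x y) (2 * t)) y
        \<le> (1 - 2 * t + (1/2)^n) * (dist x y / 2) + dist x y / 2"
      using dist_triangle[of "dyadic_walk n x (hmid x y) (2 * t)" y "hmid x y"]
        dist_hmid_right[of x y] by linarith
    also have "\<dots> = (1 - t + (1/2)^Suc n) * dist x y" by (simp add: field_simps)
    finally show ?thesis using True by simp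
  next
    case False
    have "dist (dyadic_walk n (hmid x y) y (2 * t - 1)) y
        \<le> (1 - (2 * t - 1) + (1/2)^n) * dist (hmid x y) y"
      using Suc.IH[of "2 * t - 1" "hmid x y" y] Suc.prems by simp
    also have "\<dots> \<le> (1 - (2 * t - 1) + (1/2)^n) * (dist x y / 2)"
      using dist_hmid_right[of x y] Suc.prems by (intro mult_left_mono) auto
    also have "\<dots> = (1 - t + (1/2)^Suc n) * dist x y" by (simp add: field_simps)
    finally show ?thesis using False by simp
  qed
qed

text \<open>
  The term \<open>(1/2)\<^sup>n\<close> accounts for the segment that the search has reached by stage \<open>n\<close>, of length
  at most \<open>(1/2)\<^sup>n d(x, y)\<close>, whose left end stands for all of its points. If \<open>s\<close> and \<open>t\<close> fall into
  different halves, the detour through the midpoint costs nothing.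
\<close>

lemma dyadic_walk_lipschitz:
  assumes "0 \<le> s" "s \<le> t" "t \<le> 1"
  shows "dist (dyadic_walk n x y s) (dyadic_walk n x y t) \<le> (t - s + (1/2)^n) * dist x y"
  using assms
proof (induction n arbitrary: x y s t)
  case 0
  then show ?case by simp
next
  case (Suc n)
  let ?p = "hmid x y"
  consider "t < 1/2" | "1/2 \<le> s" | "s < 1/2" "1/2 \<le> t" by linarith
  then show ?case
  proof cases
    case 1
    have "dist (dyadic_walk n x ?p (2 * s)) (dyadic_walk n x ?p (2 * t))
        \<le> (2 * t - 2 * s + (1/2)^n) * dist x ?p"
      using Suc.IH[of "2 * s" "2 * t" x ?p] Suc.prems 1 by simp
    also have "\<dots> \<le> (2 * t - 2 * s + (1/2)^n) * (dist x y / 2)"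
      using dist_hmid_left[of x y] Suc.prems by (intro mult_left_mono) auto
    also have "\<dots> = (t - s + (1/2)^Suc n) * dist x y" by (simp add: field_simps)
    finally show ?thesis using 1 Suc.prems by simp
  next
    case 2
    have "dist (dyadic_walk n ?p y (2 * s-1)) (dyadic_walk n ?p y (2 * t-1))
        \<le> ((2 * t-1) - (2 * s-1) + (1/2)^n) * dist ?p y"
      using Suc.IH[of "2 * s-1" "2 * t-1" ?p y] Suc.prems 2 by simp
    also have "\<dots> \<le> ((2 * t-1) - (2 * s-1) + (1/2)^n) * (dist x y / 2)"
      using dist_hmid_right[of x y] Suc.prems by (intro mult_left_mono) auto
    also have "\<dots> = (t - s + (1/2)^Suc n) * dist x y" by (simp add: field_simps)
    finally show ?thesis using 2 Suc.prems by simp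
  next
    case 3
    have "dist (dyadic_walk n x ?p (2 * s)) ?p \<le> (1 - 2 * s + (1/2)^n) * dist x ?p"
      using dyadic_walk_dist_right[of "2 * s" n x ?p] 3 by simp
    also have "\<dots> \<le> (1 - 2 * s + (1/2)^n) * (dist x y / 2)"
      using dist_hmid_left[of x y] 3 by (intro mult_left_mono) auto
    finally have l: "dist (dyadic_walk n x ?p (2 * s)) ?p
        \<le> (1 - 2 * s + (1/2)^n) * (dist x y / 2)" .
    have "dist ?p (dyadic_walk n ?p y (2 * t-1)) \<le> (2 * t-1) * dist ?p y"
      using dyadic_walk_dist_left[of "2 * t-1" ?p n y] 3 by simp
    also have "\<dots> \<le> (2 * t-1) * (dist x y / 2)"
      using dist_hmid_right[of x y] 3 by (intro mult_left_mono) auto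
    finally have "dist (dyadic_walk n x ?p (2 * s)) (dyadic_walk n ?p y (2 * t-1))
        \<le> (1 - 2 * s + (1/2)^n) * (dist x y / 2) + (2 * t-1) * (dist x y / 2)"
      using l dist_triangle[of "dyadic_walk n x ?p (2 * s)" "dyadic_walk n ?p y (2 * t-1)" ?p]
      by linarith
    also have "\<dots> = (t - s + (1/2)^Suc n) * dist x y" by (simp add: field_simps)
    finally show ?thesis using 3 by simp
  qed
qed

lemma dyadic_walk_refine:
  assumes "0 \<le> t" "t \<le> 1"
  shows "dist (dyadic_walk n x y t) (dyadic_walk (n + k) x y t) \<le> (1/2)^n * dist x y"
  using assms
proof (induction n arbitrary: x y t)
  case 0
  then show ?case
    using dyadic_walk_dist_left[of t x k y] mult_right_mono[of t 1 "dist x y"] by simp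
next
  case (Suc n)
  let ?p = "hmid x y"
  have half: "(1/2)^n * (dist x y / 2) = (1/2)^Suc n * dist x y" by simp
  show ?case
  proof (cases "t < 1/2")
    case True
    have "dist (dyadic_walk n x ?p (2 * t)) (dyadic_walk (n + k) x ?p (2 * t)) \<le> (1/2)^n * dist x ?p"
      using Suc.IH[of "2 * t" x ?p] Suc.prems True by simp
    also have "\<dots> \<le> (1/2)^n * (dist x y / 2)"
      using dist_hmid_left[of x y] by (intro mult_left_mono) auto
    finally show ?thesis using True unfolding half by simp
  next
    case False
    have "dist (dyadic_walk n ?p y (2 * t-1)) (dyadic_walk (n + k) ?p y (2 * t-1)) \<le> (1/2)^n * dist ?p y"
      using Suc.IH[of "2 * t-1" ?p y] Suc.prems False by simp
    also have "\<dots> \<le> (1/2)^n * (dist x y / 2)"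
      using dist_hmid_right[of x y] by (intro mult_left_mono) auto
    finally show ?thesis using False unfolding half by simp
  qed
qed

lemma dyadic_walk_convergent:
  assumes "0 \<le> t" "t \<le> 1"
  shows "convergent (\<lambda>n. dyadic_walk n x y t)"
proof -
  have "(\<lambda>n. 2 * ((1/2)^n * dist x y)) \<longlonglongrightarrow> 2 * (0 * dist x y)"
    by (intro tendsto_intros LIMSEQ_power_zero) simp
  then have lim: "(\<lambda>n. 2 * ((1/2)^n * dist x y)) \<longlonglongrightarrow> 0" by simp
  have "Cauchy (\<lambda>n. dyadic_walk n x y t)"
  proof (rule metric_CauchyI)
    fix e :: real assume "0 < e"
    from order_tendstoD(2)[OF lim this] obtain N where N: "2 * ((1/2)^N * dist x y) < e"
      by (auto simp: eventually_sequentially)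
    have "dist (dyadic_walk i x y t) (dyadic_walk j x y t) < e" if "i \<ge> N" "j \<ge> N" for i j
    proof -
      have "dist (dyadic_walk N x y t) (dyadic_walk k x y t) \<le> (1/2)^N * dist x y" if "k \<ge> N" for k
        using dyadic_walk_refine[OF assms, of N x y "k - N"] that by simp
      from this[OF that(1)] this[OF that(2)] show ?thesis
        using N dist_triangle2[of "dyadic_walk i x y t" "dyadic_walk j x y t" "dyadic_walk N x y t"]
        by (simp add: dist_commute)
    qed
    then show "\<exists>N. \<forall>i\<ge>N. \<forall>j\<ge>N. dist (dyadic_walk i x y t) (dyadic_walk j x y t) < e" by blast
  qed
  then show ?thesis by (simp add: Cauchy_convergent)
qed

text \<open>
  The limits of the binary searches satisfy \<open>d(g s, g t) \<le> \<bar>s - t\<bar> d(x, y)\<close>. Since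
  \<open>g 0 = x\<close> and \<open>g 1 = y\<close> are at distance \<open>d(x, y)\<close>, the triangle inequality leaves no room
  for strict inequality anywhere.
\<close>

lemma unit_speed_geodesic_exists: "\<exists>\<gamma>. unit_speed_geodesic \<gamma> x (y::'a::hadamard_space)"
proof (cases "x = y")
  case True
  then show ?thesis by (intro exI[of _ "\<lambda>_. x"]) (simp add: unit_speed_geodesic_def)
next
  case False
  define L where "L = dist x y"
  have L: "L > 0" using False by (simp add: L_def)
  define g where "g t = lim (\<lambda>n. dyadic_walk n x y t)" for t
  have conv: "(\<lambda>n. dyadic_walk n x y t) \<longlonglongrightarrow> g t" if "0 \<le> t" "t \<le> 1" for t
    using dyadic_walk_convergent[OF that, of x y] unfolding g_def by (simp add: convergent_LIMSEQ_iff)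
  have zero: "(\<lambda>n. (1/2::real)^n) \<longlonglongrightarrow> 0"
    by (intro LIMSEQ_power_zero) simp
  have lip: "dist (g s) (g t) \<le> (t - s) * L" if "0 \<le> s" "s \<le> t" "t \<le> 1" for s t
  proof (rule LIMSEQ_le)
    show "(\<lambda>n. dist (dyadic_walk n x y s) (dyadic_walk n x y t)) \<longlonglongrightarrow> dist (g s) (g t)"
      using that by (intro tendsto_dist conv) auto
    have "(\<lambda>n. (t - s + (1/2)^n) * L) \<longlonglongrightarrow> (t - s + 0) * L"
      by (intro tendsto_intros zero)
    then show "(\<lambda>n. (t - s + (1/2)^n) * L) \<longlonglongrightarrow> (t - s) * L" by simp
    show "\<exists>N. \<forall>n\<ge>N. dist (dyadic_walk n x y s) (dyadic_walk n x y t) \<le> (t - s + (1/2)^n) * L"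
      using dyadic_walk_lipschitz[OF that] unfolding L_def by blast
  qed
  have g0: "g 0 = x"
  proof -
    have "dyadic_walk n x y 0 = x" for n
      using dyadic_walk_dist_left[of 0 x n y] by simp
    then show ?thesis using conv[of 0] by (simp add: LIMSEQ_const_iff)
  qed
  have g1: "g 1 = y"
  proof -
    have "dist (g 1) y \<le> 0"
    proof (rule LIMSEQ_le)
      show "(\<lambda>n. dist (dyadic_walk n x y 1) y) \<longlonglongrightarrow> dist (g 1) y"
        by (intro tendsto_intros conv) auto
      have "(\<lambda>n. (1 - 1 + (1/2)^n) * L) \<longlonglongrightarrow> (1 - 1 + 0) * L"
        by (intro tendsto_intros zero)
      then show "(\<lambda>n. (1 - 1 + (1/2)^n) * L) \<longlonglongrightarrow> 0" by simp
      show "\<exists>N. \<forall>n\<ge>N. dist (dyadic_walk n x y 1) y \<le> (1 - 1 + (1/2)^n) * L"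
        using dyadic_walk_dist_right[of 1 _ x y] unfolding L_def by blast
    qed
    then show ?thesis by simp
  qed
  have iso: "dist (g s) (g t) = (t - s) * L" if "0 \<le> s" "s \<le> t" "t \<le> 1" for s t
  proof (rule antisym)
    have "L \<le> dist x (g s) + dist (g s) (g t) + dist (g t) y"
      unfolding L_def using dist_triangle[of x y "g s"] dist_triangle[of "g s" y "g t"] by linarith
    moreover have "dist x (g s) \<le> s * L" using lip[of 0 s] that g0 by simp
    moreover have "dist (g t) y \<le> (1 - t) * L" using lip[of t 1] that g1 by simp
    ultimately show "(t - s) * L \<le> dist (g s) (g t)" by (simp add: algebra_simps)
  qed (use lip that in blast)
  have iso': "dist (g (s / L)) (g (t / L)) = t - s" if "0 \<le> s" "s \<le> t" "t \<le> L" for s t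
  proof -
    have "dist (g (s / L)) (g (t / L)) = (t / L - s / L) * L"
      using that L by (intro iso) (auto simp: divide_right_mono)
    then show ?thesis using L by (simp add: left_diff_distrib)
  qed
  have "unit_speed_geodesic (\<lambda>s. g (s / L)) x y"
    unfolding unit_speed_geodesic_def L_def[symmetric]
  proof (intro conjI ballI)
    show "g (0 / L) = x" by (simp add: g0)
    show "g (L / L) = y" using L by (simp add: g1)
    fix s t assume "s \<in> {0..L}" "t \<in> {0..L}"
    then show "dist (g (s / L)) (g (t / L)) = \<bar>s - t\<bar>"
      using iso'[of s t] iso'[of t s] by (cases "s \<le> t") (auto simp: dist_commute)
  qed
  then show ?thesis by blast
qed

lemma geodesically_convex_hmid:
  assumes "geodesically_convex B" "x \<in> B" "y \<in> B"
  shows "hmid x y \<in> B"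
proof -
  obtain \<gamma> where \<gamma>: "unit_speed_geodesic \<gamma> x y" using unit_speed_geodesic_exists by blast
  let ?L = "dist x y"
  have ends: "\<gamma> 0 = x" "\<gamma> ?L = y"
    and iso: "\<And>s t. s \<in> {0..?L} \<Longrightarrow> t \<in> {0..?L} \<Longrightarrow> dist (\<gamma> s) (\<gamma> t) = \<bar>s - t\<bar>"
    using \<gamma> unfolding unit_speed_geodesic_def by blast+
  have "dist x (\<gamma> (?L/2)) = ?L / 2" "dist y (\<gamma> (?L/2)) = ?L / 2"
    using iso[of 0 "?L/2"] iso[of ?L "?L/2"] ends by auto
  then have "\<gamma> (?L/2) = hmid x y" by (rule hmid_unique)
  moreover have "\<gamma> ` {0..?L} \<subseteq> B" using assms \<gamma> unfolding geodesically_convex_def by blast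
  then have "\<gamma> (?L/2) \<in> B" by (simp add: image_subset_iff)
  ultimately show ?thesis by simp
qed

text \<open>
  Repeated halving reaches the points at the fractions \<open>2\<^sup>-\<^sup>n\<close> of the geodesic from \<open>x\<close> to \<open>y\<close>.
  These accumulate at \<open>x\<close>, which is all that first-order arguments at \<open>x\<close> require.
\<close>

primrec halving :: "'a::hadamard_space \<Rightarrow> 'a \<Rightarrow> nat \<Rightarrow> 'a" where
  "halving x y 0 = y"
| "halving x y (Suc n) = hmid x (halving x y n)"

lemma dist_halving: "dist x (halving x y n) = (1/2)^n * dist x y"
proof (induction n)
  case (Suc n)
  have "dist x (hmid x z) = dist x z / 2" for z
    using dist_hmid_left[of x z] dist_hmid_right[of x z] dist_triangle[of x z "hmid x z"] by linarith
  then show ?case using Suc by simp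
qed simp

lemma halving_inequality:
  "(dist q (halving x y n))\<^sup>2 \<le>
     (1 - (1/2)^n) * (dist q x)\<^sup>2 + (1/2)^n * (dist q y)\<^sup>2 - (1/2)^n * (1 - (1/2)^n) * (dist x y)\<^sup>2"
proof (induction n)
  case 0
  then show ?case by simp
next
  case (Suc n)
  define t where "t = (1/2::real)^n"
  have "(dist q (halving x y (Suc n)))\<^sup>2
      \<le> (1/2) * (dist q x)\<^sup>2 + (1/2) * (dist q (halving x y n))\<^sup>2 - (1/4) * (t * dist x y)\<^sup>2"
    using hmid_inequality[of q x "halving x y n"] dist_halving[of x y n]
    by (simp add: dist_commute t_def)
  also have "\<dots> \<le> (1/2) * (dist q x)\<^sup>2
      + (1/2) * ((1 - t) * (dist q x)\<^sup>2 + t * (dist q y)\<^sup>2 - t * (1 - t) * (dist x y)\<^sup>2)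
      - (1/4) * (t * dist x y)\<^sup>2"
    unfolding t_def by (intro diff_right_mono add_left_mono mult_left_mono Suc.IH) simp
  also have "\<dots> = (1 - t/2) * (dist q x)\<^sup>2 + t/2 * (dist q y)\<^sup>2 - t/2 * (1 - t/2) * (dist x y)\<^sup>2"
    by (simp add: field_simps power2_eq_square)
  finally show ?case by (simp add: t_def)
qed

lemma halving_in_convex:
  assumes "geodesically_convex B" "x \<in> B" "y \<in> B"
  shows "halving x y n \<in> B"
  by (induction n) (auto intro: geodesically_convex_hmid assms)


section \<open>Projection onto closed convex sets\<close>

text \<open>
  The midpoint inequality is a parallelogram law: the midpoint of two almost nearest points of
  \<open>B\<close> lies in \<open>B\<close>, so the two points must be close to each other, and minimizing sequences are
  Cauchy.
\<close>

lemma convex_projection_exists: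
  fixes B :: "'a::hadamard_space set"
  assumes B: "geodesically_convex B" "closed B" "B \<noteq> {}"
  obtains b where "b \<in> B" "dist m b = infdist m B"
proof -
  define h where "h = infdist m B"
  have h0: "h \<ge> 0" by (simp add: h_def infdist_nonneg)
  have "\<exists>s\<in>B. (dist m s)\<^sup>2 < h\<^sup>2 + 1 / real (Suc n)" for n
  proof -
    have "h < sqrt (h\<^sup>2 + 1 / real (Suc n))"
      using h0 by (intro real_less_rsqrt) simp
    then obtain s where s: "s \<in> B" "dist m s < sqrt (h\<^sup>2 + 1 / real (Suc n))"
      using B(3) cInf_lessD[of "dist m ` B" "sqrt (h\<^sup>2 + 1 / real (Suc n))"]
      unfolding h_def infdist_def by auto
    have "(dist m s)\<^sup>2 < (sqrt (h\<^sup>2 + 1 / real (Suc n)))\<^sup>2"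
      using s(2) by (intro power_strict_mono) auto
    then show ?thesis using s(1) by auto
  qed
  then obtain s where sB: "\<And>n. s n \<in> B" and s: "\<And>n. (dist m (s n))\<^sup>2 < h\<^sup>2 + 1 / real (Suc n)"
    by metis
  have close: "(dist (s i) (s j))\<^sup>2 \<le> 2 * (1 / real (Suc i) + 1 / real (Suc j))" for i j
  proof -
    have "h \<le> dist m (hmid (s i) (s j))"
      unfolding h_def by (intro infdist_le geodesically_convex_hmid B sB)
    then have "h\<^sup>2 \<le> (dist m (hmid (s i) (s j)))\<^sup>2" using h0 by (intro power_mono)
    then show ?thesis
      using hmid_inequality[of m "s i" "s j"] s[of i] s[of j] by (simp add: dist_commute)
  qed
  have "Cauchy s"
  proof (rule metric_CauchyI)
    fix e :: real assume e: "0 < e"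
    obtain N where N: "1 / real (Suc N) < e\<^sup>2 / 4"
      using reals_Archimedean[of "e\<^sup>2 / 4"] e by (auto simp: inverse_eq_divide)
    have "dist (s i) (s j) < e" if "i \<ge> N" "j \<ge> N" for i j
    proof -
      have "1 / real (Suc k) \<le> 1 / real (Suc N)" if "k \<ge> N" for k
        using that by (intro divide_left_mono) auto
      from this[OF that(1)] this[OF that(2)] have "(dist (s i) (s j))\<^sup>2 < e\<^sup>2"
        using close[of i j] N by argo
      then show ?thesis using e by (intro power2_less_imp_less[of _ e]) auto
    qed
    then show "\<exists>N. \<forall>i\<ge>N. \<forall>j\<ge>N. dist (s i) (s j) < e" by blast
  qed
  then obtain b where b: "s \<longlonglongrightarrow> b" using Cauchy_convergent convergent_def by blast
  have bB: "b \<in> B" using closed_sequentially[OF B(2) sB b] .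
  have "(dist m b)\<^sup>2 \<le> h\<^sup>2"
  proof (rule LIMSEQ_le)
    show "(\<lambda>n. (dist m (s n))\<^sup>2) \<longlonglongrightarrow> (dist m b)\<^sup>2" by (intro tendsto_intros b)
    have "(\<lambda>n. h\<^sup>2 + 1 / real (Suc n)) \<longlonglongrightarrow> h\<^sup>2 + 0"
      by (intro tendsto_intros LIMSEQ_Suc lim_1_over_n)
    then show "(\<lambda>n. h\<^sup>2 + 1 / real (Suc n)) \<longlonglongrightarrow> h\<^sup>2" by simp
    show "\<exists>N. \<forall>n\<ge>N. (dist m (s n))\<^sup>2 \<le> h\<^sup>2 + 1 / real (Suc n)" using s less_imp_le by blast
  qed
  then have "dist m b \<le> h" using h0 by (rule power2_le_imp_le)
  moreover have "h \<le> dist m b" unfolding h_def by (rule infdist_le[OF bB])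
  ultimately show ?thesis using that bB unfolding h_def by simp
qed

text \<open>
  The angle at the projection is at least a right angle: otherwise a short step from \<open>b\<close>
  towards \<open>y\<close>, which stays in \<open>B\<close>, would come closer to \<open>m\<close>.
\<close>

lemma projection_pythagoras:
  fixes B :: "'a::hadamard_space set"
  assumes "geodesically_convex B" "b \<in> B" "y \<in> B" and b: "dist m b = infdist m B"
  shows "(dist y b)\<^sup>2 + (dist m b)\<^sup>2 \<le> (dist y m)\<^sup>2"
proof -
  have *: "(dist m b)\<^sup>2 + (1 - (1/2)^n) * (dist b y)\<^sup>2 \<le> (dist m y)\<^sup>2" for n
  proof -
    define t where "t = (1/2::real)^n"
    have t: "t > 0" by (simp add: t_def)
    have "dist m b \<le> dist m (halving b y n)"
      unfolding b by (intro infdist_le halving_in_convex assms)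
    then have "(dist m b)\<^sup>2 \<le> (dist m (halving b y n))\<^sup>2" by (intro power_mono) auto
    then have "(dist m b)\<^sup>2 \<le> (1 - t) * (dist m b)\<^sup>2 + t * (dist m y)\<^sup>2 - t * (1 - t) * (dist b y)\<^sup>2"
      using halving_inequality[of m b y n] unfolding t_def by linarith
    then have "t * ((dist m b)\<^sup>2 + (1 - t) * (dist b y)\<^sup>2) \<le> t * (dist m y)\<^sup>2"
      by (simp add: algebra_simps)
    then show ?thesis using t unfolding t_def[symmetric] by simp
  qed
  have "(\<lambda>n. (dist m b)\<^sup>2 + (1 - (1/2)^n) * (dist b y)\<^sup>2) \<longlonglongrightarrow> (dist m b)\<^sup>2 + (1 - 0) * (dist b y)\<^sup>2"
    by (intro tendsto_intros LIMSEQ_power_zero) simp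
  then have "(dist m b)\<^sup>2 + (1 - 0) * (dist b y)\<^sup>2 \<le> (dist m y)\<^sup>2"
    by (rule LIMSEQ_le_const2) (use * in blast)
  then show ?thesis by (simp add: dist_commute)
qed


section \<open>Transformations with concave derivative\<close>

lemma S0_plus_DERIV:
  assumes "\<tau> \<in> S0_plus" "x > 0"
  shows "(\<tau> has_real_derivative deriv \<tau> x) (at x)"
  using assms by (simp add: S0_plus_def DERIV_deriv_iff_real_differentiable)

lemma S0_plus_above_tangent:
  assumes \<tau>: "\<tau> \<in> S0_plus" and "u \<ge> 0" "v > 0"
  shows "\<tau> u - \<tau> v \<ge> deriv \<tau> v * (u - v)"
proof (rule convex_on_imp_above_tangent[of "{0..}"])
  show "convex_on {0..} \<tau>" using \<tau> by (simp add: S0_plus_def)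
  show "(\<tau> has_real_derivative deriv \<tau> v) (at v within {0..})"
    using S0_plus_DERIV[OF \<tau> \<open>v > 0\<close>] by (rule has_field_derivative_at_within)
qed (use assms in \<open>auto simp: interior_real_atLeast\<close>)

lemma S0_plus_deriv_mono:
  assumes \<tau>: "\<tau> \<in> S0_plus" and "0 < u" "u \<le> v"
  shows "deriv \<tau> u \<le> deriv \<tau> v"
proof (cases "u = v")
  case False
  have "deriv \<tau> u * (v - u) \<le> deriv \<tau> v * (v - u)"
    using S0_plus_above_tangent[OF \<tau>, of u v] S0_plus_above_tangent[OF \<tau>, of v u] assms
    by (simp add: algebra_simps)
  then show ?thesis using False assms by (simp add: mult_le_cancel_right)
qed simp

lemma S0_plus_deriv_le_limit:
  assumes "\<tau> \<in> S0_plus" "(deriv \<tau> \<longlongrightarrow> D) at_top" "x > 0"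
  shows "deriv \<tau> x \<le> D"
proof (rule tendsto_lowerbound[OF assms(2)])
  show "\<forall>\<^sub>F y in at_top. deriv \<tau> x \<le> deriv \<tau> y"
    using eventually_ge_at_top[of x] by eventually_elim (rule S0_plus_deriv_mono[OF assms(1,3)])
qed simp

lemma S0_plus_limit_pos:
  assumes \<tau>: "\<tau> \<in> S0_plus" and D: "(deriv \<tau> \<longlongrightarrow> D) at_top"
  shows "0 < D"
proof -
  have "0 < deriv \<tau> 1" using \<tau> by (simp add: S0_plus_def)
  then show ?thesis using S0_plus_deriv_le_limit[OF \<tau> D, of 1] by simp
qed

lemma S0_plus_lipschitz:
  assumes \<tau>: "\<tau> \<in> S0_plus" and D: "(deriv \<tau> \<longlongrightarrow> D) at_top" and "0 \<le> u" "0 \<le> v"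
  shows "\<tau> v - \<tau> u \<le> D * \<bar>v - u\<bar>"
proof (cases "u < v")
  case True
  have "\<tau> v - \<tau> u \<le> deriv \<tau> v * (v - u)"
    using S0_plus_above_tangent[OF \<tau>, of u v] True assms by (simp add: algebra_simps)
  also have "\<dots> \<le> D * (v - u)"
    using S0_plus_deriv_le_limit[OF \<tau> D, of v] True assms by (intro mult_right_mono) auto
  finally show ?thesis using True by simp
next
  case False
  have "\<tau> v \<le> \<tau> u"
    using \<tau> False assms unfolding S0_plus_def mono_on_def by auto
  moreover have "0 \<le> D * \<bar>v - u\<bar>" using S0_plus_limit_pos[OF \<tau> D] by simp
  ultimately show ?thesis by linarith
qed

lemma S0_plus_deriv_over_id_antimono:
  assumes \<tau>: "\<tau> \<in> S0_plus" and xy: "0 < x" "x \<le> y"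
  shows "deriv \<tau> y / y \<le> deriv \<tau> x / x"
proof (cases "x = y")
  case False
  have pos: "deriv \<tau> u > 0" if "u > 0" for u using \<tau> that by (simp add: S0_plus_def)
  have conc: "concave_on {0<..} (deriv \<tau>)" using \<tau> by (simp add: S0_plus_def)
  (* Concavity on the segment from e to y, with the value at e discarded; then e tends to 0. *)
  have *: "(x - e) / (y - e) * deriv \<tau> y \<le> deriv \<tau> x" if e: "0 < e" "e < x" for e
  proof -
    define \<theta> where "\<theta> = (x - e) / (y - e)"
    have \<theta>: "0 \<le> \<theta>" "\<theta> \<le> 1" using e xy by (auto simp: \<theta>_def field_simps)
    have "(1 - \<theta>) * deriv \<tau> e + \<theta> * deriv \<tau> y \<le> deriv \<tau> ((1 - \<theta>) * e + \<theta> * y)"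
      using concave_onD[OF conc \<theta>, of e y] e xy by simp
    also have "(1 - \<theta>) * e + \<theta> * y = e + \<theta> * (y - e)" by (simp add: algebra_simps)
    also have "\<dots> = x" using e xy by (simp add: \<theta>_def)
    finally have "(1 - \<theta>) * deriv \<tau> e + \<theta> * deriv \<tau> y \<le> deriv \<tau> x" .
    moreover have "0 \<le> (1 - \<theta>) * deriv \<tau> e" using \<theta> pos[OF e(1)] by simp
    ultimately show ?thesis unfolding \<theta>_def by linarith
  qed
  have "((\<lambda>e. (x - e) / (y - e) * deriv \<tau> y) \<longlongrightarrow> (x - 0) / (y - 0) * deriv \<tau> y) (at_right 0)"
    using xy by (intro tendsto_intros) auto
  moreover have "\<forall>\<^sub>F e in at_right 0. (x - e) / (y - e) * deriv \<tau> y \<le> deriv \<tau> x"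
    using eventually_at_right_less[of "0::real"] eventually_at_right_real[OF xy(1)]
    by eventually_elim (use * in auto)
  ultimately have "(x - 0) / (y - 0) * deriv \<tau> y \<le> deriv \<tau> x"
    by (rule tendsto_upperbound) simp
  then show ?thesis using xy by (simp add: field_simps)
qed simp

text \<open>
  The map \<open>s \<mapsto> \<tau> (\<surd>s)\<close> has derivative \<open>\<tau>' (\<surd>s) / (2 \<surd>s)\<close>, which decreases because \<open>\<tau>'\<close> is
  concave and positive. Hence it is concave and lies below its tangents. This turns bounds on
  squared distances, which is what the geometry supplies, into bounds on \<open>\<tau>\<close> of distances.
\<close>

lemma S0_plus_below_square_tangent:
  assumes \<tau>: "\<tau> \<in> S0_plus" and "x > 0" "A > 0"
  shows "\<tau> x - \<tau> A \<le> deriv \<tau> A / (2 * A) * (x\<^sup>2 - A\<^sup>2)"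
proof -
  define k where "k = deriv \<tau> A / A"
  define \<phi> where "\<phi> u = k / 2 * u\<^sup>2 - \<tau> u" for u
  have d: "(\<phi> has_real_derivative (k * u - deriv \<tau> u)) (at u)" if "u > 0" for u
    unfolding \<phi>_def using S0_plus_DERIV[OF \<tau> that]
    by (auto intro!: derivative_eq_intros)
  have "\<phi> A \<le> \<phi> x"
  proof (cases "A \<le> x")
    case True
    show ?thesis
    proof (rule DERIV_nonneg_imp_nondecreasing[OF True])
      fix u assume u: "A \<le> u" "u \<le> x"
      have "deriv \<tau> u / u \<le> k"
        unfolding k_def by (rule S0_plus_deriv_over_id_antimono[OF \<tau> \<open>A > 0\<close> u(1)])
      then have "k * u - deriv \<tau> u \<ge> 0" using u \<open>A > 0\<close> by (simp add: field_simps)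
      then show "\<exists>y. (\<phi> has_real_derivative y) (at u) \<and> 0 \<le> y" using d[of u] u \<open>A > 0\<close> by auto
    qed
  next
    case False
    show ?thesis
    proof (rule DERIV_nonpos_imp_nonincreasing[of x A])
      fix u assume u: "x \<le> u" "u \<le> A"
      have "k \<le> deriv \<tau> u / u"
        unfolding k_def using u \<open>x > 0\<close> by (intro S0_plus_deriv_over_id_antimono[OF \<tau>]) auto
      then have "k * u - deriv \<tau> u \<le> 0" using u \<open>x > 0\<close> by (simp add: field_simps)
      then show "\<exists>y. (\<phi> has_real_derivative y) (at u) \<and> y \<le> 0" using d[of u] u \<open>x > 0\<close> by auto
    qed (use False in simp)
  qed
  then have "\<tau> x - \<tau> A \<le> k / 2 * (x\<^sup>2 - A\<^sup>2)"
    unfolding \<phi>_def by (simp add: right_diff_distrib)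
  then show ?thesis by (simp add: k_def mult.commute)
qed

text \<open>
  Up to the factor \<open>-1\<close>, the right-hand side bounds the derivative at \<open>m\<close> of \<open>\<tau> (d(y, \<cdot>))\<close>
  in the direction of the projection \<open>b\<close>, where \<open>A = d(y, m)\<close>, \<open>c = d(y, b)\<close> and
  \<open>h = d(m, b)\<close>. The worst case is a right angle at \<open>b\<close> with \<open>c = \<delta>\<close>, so that \<open>A = S\<close>.
  For smaller \<open>A\<close> the decay of \<open>\<tau>'\<close> is compensated by a better angle at \<open>m\<close>, because
  \<open>\<tau>' A / A\<close> decreases; for larger \<open>A\<close> both \<open>\<tau>'\<close> and the angle improve.
\<close>

lemma S0_plus_projection_slope:
  assumes \<tau>: "\<tau> \<in> S0_plus" and h: "h > 0" and c: "0 \<le> c" "c \<le> \<delta>"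
    and A: "A > 0" "c\<^sup>2 + h\<^sup>2 \<le> A\<^sup>2" and S: "S = sqrt (h\<^sup>2 + \<delta>\<^sup>2)"
  shows "deriv \<tau> S * (h / S) \<le> deriv \<tau> A * (A\<^sup>2 + h\<^sup>2 - c\<^sup>2) / (2 * A * h)"
proof -
  have S2: "S\<^sup>2 = h\<^sup>2 + \<delta>\<^sup>2" unfolding S by simp
  have S0: "S > 0" unfolding S using h by (simp add: add_pos_nonneg)
  have pos: "deriv \<tau> A > 0" "deriv \<tau> S > 0" using \<tau> A S0 by (auto simp: S0_plus_def)
  have "deriv \<tau> S * (2 * h\<^sup>2 / S) \<le> deriv \<tau> A * ((A\<^sup>2 + h\<^sup>2 - c\<^sup>2) / A)"
  proof (cases "A \<le> S")
    case True
    have "deriv \<tau> S / S * (2 * h\<^sup>2) \<le> deriv \<tau> A / A * (A\<^sup>2 + h\<^sup>2 - c\<^sup>2)"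
      using S0_plus_deriv_over_id_antimono[OF \<tau> A(1) True] A pos
      by (intro mult_mono) auto
    then show ?thesis by simp
  next
    case False
    have "0 \<le> (A - S) * (S * A - (h\<^sup>2 - \<delta>\<^sup>2))"
    proof (rule mult_nonneg_nonneg)
      have "S\<^sup>2 \<le> S * A" using False S0 by (simp add: power2_eq_square)
      moreover have "h\<^sup>2 - \<delta>\<^sup>2 \<le> S\<^sup>2" unfolding S2 by simp
      ultimately show "0 \<le> S * A - (h\<^sup>2 - \<delta>\<^sup>2)" by linarith
    qed (use False in simp)
    also have "\<dots> = S * (A\<^sup>2 + h\<^sup>2 - \<delta>\<^sup>2) - A * (h\<^sup>2 - \<delta>\<^sup>2 + S\<^sup>2)"
      by (simp add: algebra_simps power2_eq_square)
    also have "\<dots> = S * (A\<^sup>2 + h\<^sup>2 - \<delta>\<^sup>2) - A * (2 * h\<^sup>2)" unfolding S2 by simp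
    also have "\<dots> \<le> S * (A\<^sup>2 + h\<^sup>2 - c\<^sup>2) - A * (2 * h\<^sup>2)"
      using S0 c power_mono[of c \<delta> 2] by (simp add: mult_left_mono)
    finally have "2 * h\<^sup>2 / S \<le> (A\<^sup>2 + h\<^sup>2 - c\<^sup>2) / A"
      using S0 A(1) by (simp add: field_simps)
    then show ?thesis
      using S0_plus_deriv_mono[OF \<tau> S0, of A] False pos S0 by (intro mult_mono) auto
  qed
  then have "deriv \<tau> S * (2 * h\<^sup>2 / S) / (2 * h) \<le> deriv \<tau> A * ((A\<^sup>2 + h\<^sup>2 - c\<^sup>2) / A) / (2 * h)"
    using h by (intro divide_right_mono) auto
  then show ?thesis using h by (simp add: power2_eq_square mult_ac)
qed

lemma S0_plus_dist_measurable:
  fixes Y :: "'w \<Rightarrow> 'a::metric_space"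
  assumes \<tau>: "\<tau> \<in> S0_plus" and Y: "Y \<in> measurable M borel"
  shows "(\<lambda>\<omega>. \<tau> (dist (Y \<omega>) q)) \<in> borel_measurable M"
proof -
  (* Values of \<tau> at negative arguments are arbitrary, so its argument is truncated at 0. *)
  have "mono (\<lambda>x. \<tau> (max 0 x))"
    using \<tau> unfolding S0_plus_def mono_on_def mono_def by (auto simp: max_def)
  then have "(\<lambda>x. \<tau> (max 0 x)) \<in> borel_measurable borel" by (rule borel_measurable_mono)
  moreover have "(\<lambda>x. dist x q) \<in> borel_measurable borel"
    by (intro borel_measurable_continuous_onI continuous_intros)
  then have "(\<lambda>\<omega>. dist (Y \<omega>) q) \<in> borel_measurable M" using Y by (rule measurable_compose_rev)
  ultimately have "(\<lambda>\<omega>. \<tau> (max 0 (dist (Y \<omega>) q))) \<in> borel_measurable M"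
    by (rule measurable_compose_rev)
  then show ?thesis by simp
qed

lemma S0_plus_increment_integrable:
  fixes Y :: "'w \<Rightarrow> 'a::metric_space"
  assumes \<tau>: "\<tau> \<in> S0_plus" and D: "(deriv \<tau> \<longlongrightarrow> D) at_top"
    and "prob_space M" and Y: "Y \<in> measurable M borel"
  shows "integrable M (\<lambda>\<omega>. \<tau> (dist (Y \<omega>) q) - \<tau> (dist (Y \<omega>) r))"
proof -
  interpret prob_space M by fact
  have D0: "0 \<le> D" using S0_plus_limit_pos[OF \<tau> D] by simp
  have *: "\<tau> (dist y q) - \<tau> (dist y r) \<le> D * dist q r" for y q r :: 'a
    using S0_plus_lipschitz[OF \<tau> D, of "dist y r" "dist y q"]
      mult_left_mono[OF abs_dist_diff_le[of q y r] D0] by (simp add: dist_commute)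
  have bound: "norm (\<tau> (dist y q) - \<tau> (dist y r)) \<le> D * dist q r" for y
    using *[of y q r] *[of y r q] by (simp add: dist_commute[of r q] abs_le_iff)
  show ?thesis
    by (rule integrable_const_bound[OF AE_I2[OF bound]])
      (intro borel_measurable_diff S0_plus_dist_measurable \<tau> Y)
qed


section \<open>Robustness of transformed Frechet means\<close>

text \<open>
  The first-order condition at \<open>m\<close> in the direction of the projection \<open>b\<close>. A step of length \<open>t h\<close>
  lowers the integrand by at least \<open>t h \<tau>' S (h / S)\<close> on the event \<open>Y \<in> B\<close>, up to an error of
  order \<open>t\<^sup>2\<close> that is uniform in \<open>Y\<close>, and raises it by at most \<open>t h D\<close> elsewhere. As \<open>m\<close> is a
  minimizer, the expected gain cannot exceed the expected loss; divide by \<open>t h\<close> and let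
  \<open>t \<rightarrow> 0\<close>.
\<close>

lemma frechet_mean_first_order:
  fixes Y :: "'w \<Rightarrow> 'a::hadamard_space"
  assumes \<tau>: "\<tau> \<in> S0_plus" and D: "(deriv \<tau> \<longlongrightarrow> D) at_top"
    and M: "prob_space M" and Y: "Y \<in> measurable M borel"
    and m: "frechet_mean \<tau> M Y z m"
    and B: "geodesically_convex B" "closed B" "B \<noteq> {}" "bounded B" "diameter B \<le> \<delta>"
    and \<rho>: "\<rho> = measure M {\<omega> \<in> space M. Y \<omega> \<in> B}"
    and h: "h = infdist m B" "h > 0"
    and S: "S = sqrt (h\<^sup>2 + \<delta>\<^sup>2)"
  shows "\<rho> * (deriv \<tau> S * (h / S)) \<le> (1 - \<rho>) * D"
proof -
  interpret prob_space M by fact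
  obtain b where b: "b \<in> B" "dist m b = h"
    using convex_projection_exists[OF B(1-3), of m] h(1) by metis
  have D0: "0 \<le> D" using S0_plus_limit_pos[OF \<tau> D] by simp
  define s where "s = deriv \<tau> S * (h / S)"
  define E where "E = {\<omega> \<in> space M. Y \<omega> \<in> B}"
  have E: "E \<in> sets M"
    unfolding E_def using measurable_sets[OF Y, of B] B(2)
    by (simp add: borel_closed vimage_def Int_def conj_commute)
  have step: "0 \<le> (1 - \<rho>) * D - \<rho> * s + (1/2)^n * (\<rho> * D / 2)" if n: "n \<ge> 1" for n
  proof -
    define t where "t = (1/2::real)^n"
    have t: "0 < t" "t < 1" using n by (auto simp: t_def power_less_one_iff)
    define p where "p = halving m b n"
    have mp: "dist m p = t * h" using dist_halving[of m b n] b(2) by (simp add: p_def t_def)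
    have off: "\<tau> (dist y p) - \<tau> (dist y m) \<le> D * (t * h)" for y
      using S0_plus_lipschitz[OF \<tau> D, of "dist y m" "dist y p"]
        mult_left_mono[OF abs_dist_diff_le[of p y m] D0] mp by (simp add: dist_commute)
    have on: "\<tau> (dist y p) - \<tau> (dist y m) \<le> - (t * h * (s - t * D / 2))" if y: "y \<in> B" for y
    proof -
      define A c where "A = dist y m" and "c = dist y b"
      have c: "0 \<le> c" "c \<le> \<delta>"
        using diameter_bounded_bound[OF B(4) y b(1)] B(5) by (auto simp: c_def)
      have pyth: "c\<^sup>2 + h\<^sup>2 \<le> A\<^sup>2"
        using projection_pythagoras[OF B(1) b(1) y, of m] b(2) h(1) by (simp add: A_def c_def)
      have hA: "h \<le> A"
        unfolding A_def h(1) using infdist_le[OF y, of m] by (simp add: dist_commute)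
      then have A: "A > 0" using h(2) by simp
      have "t * h < h" using t h(2) by simp
      moreover have "A \<le> dist y p + t * h"
        using dist_triangle2[of y m p] mp unfolding A_def by simp
      ultimately have p0: "dist y p > 0" using hA by linarith
      have dp: "deriv \<tau> A / (2 * A) \<ge> 0" using \<tau> A by (simp add: S0_plus_def less_imp_le)
      have sq: "(dist y p)\<^sup>2 - A\<^sup>2 \<le> - t * (A\<^sup>2 + h\<^sup>2 - c\<^sup>2) + t\<^sup>2 * h\<^sup>2"
        using halving_inequality[of y m b n]
        unfolding p_def[symmetric] t_def[symmetric] b(2) A_def[symmetric] c_def[symmetric]
        by (simp add: algebra_simps power2_eq_square)
      have "\<tau> (dist y p) - \<tau> A \<le> deriv \<tau> A / (2 * A) * ((dist y p)\<^sup>2 - A\<^sup>2)"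
        by (rule S0_plus_below_square_tangent[OF \<tau> p0 A])
      also have "\<dots> \<le> deriv \<tau> A / (2 * A) * (- t * (A\<^sup>2 + h\<^sup>2 - c\<^sup>2) + t\<^sup>2 * h\<^sup>2)"
        using sq dp by (rule mult_left_mono)
      also have "\<dots> = - (t * h * (deriv \<tau> A * (A\<^sup>2 + h\<^sup>2 - c\<^sup>2) / (2 * A * h)))
          + t\<^sup>2 * h / 2 * (deriv \<tau> A * (h / A))"
        using A h(2) by (simp add: field_simps power2_eq_square)
      also have "\<dots> \<le> - (t * h * s) + t\<^sup>2 * h / 2 * D"
      proof (intro add_mono le_imp_neg_le mult_left_mono)
        show "s \<le> deriv \<tau> A * (A\<^sup>2 + h\<^sup>2 - c\<^sup>2) / (2 * A * h)"
          unfolding s_def by (rule S0_plus_projection_slope[OF \<tau> h(2) c A pyth S])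
        have "deriv \<tau> A * (h / A) \<le> D * 1"
          using S0_plus_deriv_le_limit[OF \<tau> D A] hA A h(2) D0
          by (intro mult_mono) auto
        then show "deriv \<tau> A * (h / A) \<le> D" by simp
      qed (use t h(2) in auto)
      also have "\<dots> = - (t * h * (s - t * D / 2))" by (simp add: algebra_simps power2_eq_square)
      finally show ?thesis unfolding A_def .
    qed
    let ?f = "\<lambda>q \<omega>. \<tau> (dist (Y \<omega>) q) - \<tau> (dist (Y \<omega>) z)"
    let ?u = "\<lambda>\<omega>. D * (t * h) - (D * (t * h) + t * h * (s - t * D / 2)) * indicator E \<omega>"
    have int: "integrable M (\<lambda>\<omega>. \<tau> (dist (Y \<omega>) q) - \<tau> (dist (Y \<omega>) r))" for q r
      by (rule S0_plus_increment_integrable[OF \<tau> D M Y])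
    have intE: "integrable M (indicator E :: _ \<Rightarrow> real)"
      using E by (simp add: integrable_indicator_iff emeasure_eq_measure)
    have "0 \<le> (\<integral>\<omega>. ?f p \<omega> \<partial>M) - (\<integral>\<omega>. ?f m \<omega> \<partial>M)"
      using m unfolding frechet_mean_def is_arg_min_linorder by simp
    also have "\<dots> = (\<integral>\<omega>. ?f p \<omega> - ?f m \<omega> \<partial>M)"
      by (rule Bochner_Integration.integral_diff[symmetric]) (rule int)+
    also have "\<dots> = (\<integral>\<omega>. \<tau> (dist (Y \<omega>) p) - \<tau> (dist (Y \<omega>) m) \<partial>M)"
      by simp
    also have "\<dots> \<le> (\<integral>\<omega>. ?u \<omega> \<partial>M)"
    proof (rule integral_mono[OF int])
      show "integrable M ?u" using intE by (intro Bochner_Integration.integrable_diff) auto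
      fix \<omega> assume "\<omega> \<in> space M"
      then show "\<tau> (dist (Y \<omega>) p) - \<tau> (dist (Y \<omega>) m) \<le> ?u \<omega>"
        using on[of "Y \<omega>"] off[of "Y \<omega>"] by (auto simp: E_def indicator_def)
    qed
    also have "\<dots> = D * (t * h) - (D * (t * h) + t * h * (s - t * D / 2)) * \<rho>"
      using intE E prob_space unfolding \<rho> E_def[symmetric] by simp
    also have "\<dots> = t * h * ((1 - \<rho>) * D - \<rho> * s + t * (\<rho> * D / 2))"
      by (simp add: algebra_simps)
    finally have "0 \<le> t * h * ((1 - \<rho>) * D - \<rho> * s + t * (\<rho> * D / 2))" .
    moreover have "0 < t * h" using t h(2) by simp
    ultimately have "0 \<le> (1 - \<rho>) * D - \<rho> * s + t * (\<rho> * D / 2)"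
      by (simp only: zero_le_mult_iff) linarith
    then show ?thesis unfolding t_def .
  qed
  have "(\<lambda>n. (1 - \<rho>) * D - \<rho> * s + (1/2)^n * (\<rho> * D / 2))
      \<longlonglongrightarrow> (1 - \<rho>) * D - \<rho> * s + 0 * (\<rho> * D / 2)"
    by (intro tendsto_intros LIMSEQ_power_zero) simp
  then have "0 \<le> (1 - \<rho>) * D - \<rho> * s + 0 * (\<rho> * D / 2)"
    by (rule LIMSEQ_le_const) (use step in blast)
  then show ?thesis unfolding s_def by simp
qed

theorem theorem4p2:
  fixes \<tau> :: "real \<Rightarrow> real"
    and M :: "'w measure"
    and Y :: "'w \<Rightarrow> 'a::hadamard_space"
    and z m :: 'a
    and B :: "'a set"
    and D \<delta> \<rho> R lam a x0 :: real
  assumes "\<tau> \<in> S0_plus"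
    and "(deriv \<tau> \<longlongrightarrow> D) at_top"
    and "prob_space M"
    and "Y \<in> measurable M borel"
    and "\<exists>S. separable_space (top_of_set S) \<and>
             {\<omega> \<in> space M. Y \<omega> \<in> S} \<in> sets M \<and> measure M {\<omega> \<in> space M. Y \<omega> \<in> S} = 1"
    and "frechet_mean \<tau> M Y z m"
    and "geodesically_convex B" and "closed B"
    and "0 \<le> \<delta>" and "bounded B" and "diameter B \<le> \<delta>"
    and "\<rho> = measure M {\<omega> \<in> space M. Y \<omega> \<in> B}"
    and "0 < R" and "0 < lam" and "lam \<le> 1" and "\<tau> R \<ge> lam * D * R"
    and "\<rho> > 1 / (1 + lam)"
    and "a = (1 - \<rho>) / \<rho>"
    and "x0 = \<delta> / (lam - a) * ((a + lam * sqrt (1 - lam\<^sup>2 + a\<^sup>2)) / (a + lam))"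
  shows "(infdist m B)\<^sup>2 \<le> max (x0\<^sup>2) (R\<^sup>2 - \<delta>\<^sup>2)"
proof (rule ccontr)
  note \<tau> = assms(1) and D = assms(2) and M = assms(3) and Y = assms(4)
  interpret prob_space M by fact
  assume "\<not> ?thesis"
  then have far: "x0\<^sup>2 < (infdist m B)\<^sup>2" "R\<^sup>2 - \<delta>\<^sup>2 < (infdist m B)\<^sup>2" by auto
  define h where "h = infdist m B"
  define S where "S = sqrt (h\<^sup>2 + \<delta>\<^sup>2)"
  have h0: "h \<ge> 0" by (simp add: h_def infdist_nonneg)
  have \<rho>: "0 < \<rho>" "\<rho> \<le> 1"
    using assms(14,17) by (auto simp: assms(12) intro: less_trans[rotated])
  have a: "0 \<le> a" "a < lam" using \<rho> assms(14,17) by (auto simp: assms(18) field_simps)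
  have "B \<noteq> {}" using \<rho>(1) assms(12) by auto
  have h: "h > 0" using far(1) h0 zero_le_power2[of x0] unfolding h_def
    by (metis le_less not_less power_zero_numeral)
  have D0: "D > 0" by (rule S0_plus_limit_pos[OF \<tau> D])
  have S0: "S > 0" and S2: "S\<^sup>2 = h\<^sup>2 + \<delta>\<^sup>2" using h by (auto simp: S_def add_pos_nonneg)
  have "R\<^sup>2 \<le> S\<^sup>2" using far(2) unfolding S2 h_def by simp
  then have RS: "R \<le> S" using S0 by (auto intro: power2_le_imp_le)
  have "\<tau> R \<le> deriv \<tau> R * R"
    using S0_plus_above_tangent[OF \<tau>, of 0 R] assms(13) \<tau> by (simp add: S0_plus_def)
  then have "lam * D * R \<le> deriv \<tau> R * R" using assms(16) by linarith
  then have "lam * D \<le> deriv \<tau> R" using assms(13) by (rule mult_right_le_imp_le)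
  then have slope: "lam * D \<le> deriv \<tau> S"
    using S0_plus_deriv_mono[OF \<tau> assms(13) RS] by simp
  have "\<rho> * (lam * D * (h / S)) \<le> \<rho> * (deriv \<tau> S * (h / S))"
    using slope \<rho> h S0 by (intro mult_left_mono mult_right_mono) auto
  also have "\<dots> \<le> (1 - \<rho>) * D"
    by (rule frechet_mean_first_order[OF \<tau> D M Y assms(6,7,8) \<open>B \<noteq> {}\<close> assms(10,11,12)
          h_def h S_def])
  also have "(1 - \<rho>) * D = \<rho> * (a * D)" using \<rho> by (simp add: assms(18))
  finally have "lam * h \<le> a * S" using \<rho> D0 S0 by (simp add: field_simps)
  then have "(lam * h)\<^sup>2 \<le> (a * S)\<^sup>2" using assms(14) h by (intro power_mono) auto
  then have upper: "(lam\<^sup>2 - a\<^sup>2) * h\<^sup>2 \<le> (a * \<delta>)\<^sup>2"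
    unfolding power_mult_distrib S2 by (simp add: algebra_simps)
  define w where "w = lam\<^sup>2 - a\<^sup>2"
  have "w > 0" using a power_strict_mono[of a lam 2] by (simp add: w_def)
  moreover have "lam\<^sup>2 - a\<^sup>2 \<le> 1"
    using power_le_one[of lam 2] assms(14,15) zero_le_power2[of a] by linarith
  ultimately have w: "w > 0" "w \<le> 1" unfolding w_def by auto
  have w_eq: "w = (lam - a) * (a + lam)" by (simp add: w_def algebra_simps power2_eq_square)
  (* The bound on h is a \<delta> / sqrt w, and a \<delta> / w exceeds it because w is at most 1. *)
  have "a * \<delta> / w \<le> x0"
  proof -
    have "0 \<le> lam * sqrt (1 - lam\<^sup>2 + a\<^sup>2)"
      using assms(14) w(2) unfolding w_def by simp
    then have "\<delta> * a \<le> \<delta> * (a + lam * sqrt (1 - lam\<^sup>2 + a\<^sup>2))"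
      using assms(9) by (intro mult_left_mono) auto
    then have "\<delta> * a / w \<le> \<delta> * (a + lam * sqrt (1 - lam\<^sup>2 + a\<^sup>2)) / w"
      using w(1) by (intro divide_right_mono) auto
    also have "\<dots> = x0" unfolding assms(19) w_eq by simp
    finally show ?thesis by (simp add: mult.commute)
  qed
  then have "(a * \<delta> / w)\<^sup>2 \<le> x0\<^sup>2" using a assms(9) w by (intro power_mono) auto
  also have "\<dots> < h\<^sup>2" using far(1) by (simp add: h_def)
  finally have "(a * \<delta>)\<^sup>2 < w\<^sup>2 * h\<^sup>2" using w(1) by (simp add: power_divide field_simps)
  also have "\<dots> \<le> w * h\<^sup>2"
    using w by (intro mult_right_mono) (auto simp: power2_eq_square mult_left_le)
  finally show False using upper by (simp add: w_def)
qed

end
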